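(* Let $A$ be a formula with $\dim[\![A]\!]>0$. Then: (i) the set $\{[\![\underline{m}_A]\!]\}_{m\ge0}$ of denotations of integers is linearly independent in $[\![\mathbf{int}_A]\!]$; (ii) the set $\{[\![\underline{i}_A]\!]\}_{i=0}^{n-1}$ is linearly independent in $[\![{}_n\mathbf{bool}_A]\!]$ (for each $n\ge1$).
   Context: $k$ is an algebraically closed field. Formulas are those of first-order intuitionistic linear logic with connectives $\otimes,\&,\multimap,!$. The *Sweedler semantics* $[\![-]\!]$: chosen $k$-vector spaces for atoms, $[\![A\otimes B]\!]=[\![A]\!]\otimes[\![B]\!]$, $[\![A\&B]\!]=[\![A]\!]\oplus[\![B]\!]$, $[\![A\multimap B]\!]=\mathrm{Hom}_k([\![A]\!],[\![B]\!])$, $[\![!A]\!]={!}[\![A]\!]$, where $!V$ is the universal (cofree) cocommutative coassociative counital coalgebra with universal linear map $d:{!}V\to V$. Proofs denote linear maps in the standard way: dereliction is $d$, contraction is comultiplication, weakening is the counit, promotion is the unique lift to a coalgebra morphism, cut is composition; a proof of $\vdash B$ denotes an element of $[\![B]\!]$. $\mathbf{int}_A={!}(A\multimap A)\multimap(A\multimap A)$ and $\underline{m}_A$ is the proof of $\mathbf{int}_A$ (Church numeral) given by the term $\lambda!u.\lambda a.\,u(u(\cdots u(a)\cdots))$ with $m$ occurrences of $u$ (each derelicted, then all contracted; a weakening if $m=0$). Thus $[\![\underline{m}_A]\!]:{!}V\to V$, $V=\mathrm{End}_k([\![A]\!])$, is the iterated comultiplication ${!}V\to({!}V)^{\otimes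 m}$ followed by $d^{\otimes m}$ and composition of endomorphisms; in particular it sends the group-like element over $\alpha\in V$ to $\alpha^m$. ${}_n\mathbf{bool}_A=A^n\multimap A$ with $A^n=A\&\cdots\&A$ ($n$ copies), and $\underline{i}_A$ is the proof whose denotation is the $i$-th projection $[\![A]\!]^{\oplus n}\to[\![A]\!]$, $0\le i\le n-1$. *)

theory Defs
  imports
    "HOL-Library.Poly_Mapping"
    "HOL-Computational_Algebra.Polynomial"
begin

section \<open>Formulas and proofs\<close>

datatype 'a fm =
    Atom 'a
  | Tensor "'a fm" "'a fm"
  | With "'a fm" "'a fm"
  | Limp "'a fm" "'a fm"
  | Bang "'a fm"

text \<open>Sequent calculus trees. A node carries the context or the formulas of its premises
  that its denotation depends on.\<close>

datatype 'a deduction =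
    Ax "'a fm"
  | Cut "'a fm list" "'a deduction" "'a deduction"
  | Exch "'a fm list" "'a deduction"
  | TensorL "'a fm" "'a fm" "'a deduction"
  | TensorR "'a fm list" "'a fm" "'a fm" "'a deduction" "'a deduction"
  | WithL1 "'a fm" "'a fm" "'a deduction"
  | WithL2 "'a fm" "'a fm" "'a deduction"
  | WithR "'a fm" "'a fm" "'a deduction" "'a deduction"
  | LimpL "'a fm list" "'a fm" "'a fm" "'a deduction" "'a deduction"
  | LimpR "'a fm" "'a fm" "'a deduction"
  | Der "'a fm" "'a deduction"
  | Contr "'a fm" "'a deduction"
  | Weak "'a fm" "'a deduction"
  | Prom "'a fm list" "'a fm" "'a deduction"

inductive proves :: "'a deduction \<Rightarrow> 'a fm list \<Rightarrow> 'a fm \<Rightarrow> bool" where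
  "proves (Ax A) [A] A"
| "proves p \<Gamma> A \<Longrightarrow> proves q (A # \<Delta>) B \<Longrightarrow> proves (Cut \<Gamma> p q) (\<Gamma> @ \<Delta>) B"
| "proves p (\<Gamma> @ A # B # \<Delta>) C \<Longrightarrow> proves (Exch \<Gamma> p) (\<Gamma> @ B # A # \<Delta>) C"
| "proves p (A # B # \<Gamma>) C \<Longrightarrow> proves (TensorL A B p) (Tensor A B # \<Gamma>) C"
| "proves p \<Gamma> A \<Longrightarrow> proves q \<Delta> B \<Longrightarrow> proves (TensorR \<Gamma> A B p q) (\<Gamma> @ \<Delta>) (Tensor A B)"
| "proves p (A # \<Gamma>) C \<Longrightarrow> proves (WithL1 A B p) (With A B # \<Gamma>) C"
| "proves p (B # \<Gamma>) C \<Longrightarrow> proves (WithL2 A B p) (With A B # \<Gamma>) C"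
| "proves p \<Gamma> A \<Longrightarrow> proves q \<Gamma> B \<Longrightarrow> proves (WithR A B p q) \<Gamma> (With A B)"
| "proves p \<Gamma> A \<Longrightarrow> proves q (B # \<Delta>) C \<Longrightarrow>
     proves (LimpL \<Gamma> A B p q) (Limp A B # \<Gamma> @ \<Delta>) C"
| "proves p (\<Gamma> @ [A]) B \<Longrightarrow> proves (LimpR A B p) \<Gamma> (Limp A B)"
| "proves p (A # \<Gamma>) B \<Longrightarrow> proves (Der A p) (Bang A # \<Gamma>) B"
| "proves p (Bang A # Bang A # \<Gamma>) B \<Longrightarrow> proves (Contr A p) (Bang A # \<Gamma>) B"
| "proves p \<Gamma> B \<Longrightarrow> proves (Weak A p) (Bang A # \<Gamma>) B"
| "proves p (map Bang \<Gamma>) A \<Longrightarrow> proves (Prom \<Gamma> A p) (map Bang \<Gamma>) (Bang A)"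

subsection \<open>Integers and booleans\<close>

definition int_fm :: "'a fm \<Rightarrow> 'a fm" where
  "int_fm A = Limp (Bang (Limp A A)) (Limp A A)"

text \<open>\<open>church_body A m\<close> proves \<open>!(A \<multimap> A), \<dots>, !(A \<multimap> A), A \<turnstile> A\<close> with \<open>m\<close> copies of
  \<open>!(A \<multimap> A)\<close>, each of them derelicted; \<open>contract m\<close> merges \<open>m\<close> copies into one.\<close>

primrec church_body :: "'a fm \<Rightarrow> nat \<Rightarrow> 'a deduction" where
  "church_body A 0 = Ax A"
| "church_body A (Suc m) =
     Der (Limp A A)
       (LimpL (replicate m (Bang (Limp A A)) @ [A]) A A (church_body A m) (Ax A))"

fun contract :: "'a fm \<Rightarrow> nat \<Rightarrow> 'a deduction \<Rightarrow> 'a deduction" where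
  "contract A 0 p = Weak A p"
| "contract A (Suc 0) p = p"
| "contract A (Suc (Suc m)) p = contract A (Suc m) (Contr A p)"

definition church :: "'a fm \<Rightarrow> nat \<Rightarrow> 'a deduction" where
  "church A m =
     LimpR (Bang (Limp A A)) (Limp A A)
       (LimpR A A (contract (Limp A A) m (church_body A m)))"

text \<open>The case \<open>n = 0\<close> is a dummy: the additive unit is not part of the language.\<close>

fun with_power :: "'a fm \<Rightarrow> nat \<Rightarrow> 'a fm" where
  "with_power A (Suc (Suc n)) = With A (with_power A (Suc n))"
| "with_power A n = A"

definition bool_fm :: "nat \<Rightarrow> 'a fm \<Rightarrow> 'a fm" where
  "bool_fm n A = Limp (with_power A n) A"

fun projection :: "'a fm \<Rightarrow> nat \<Rightarrow> nat \<Rightarrow> 'a deduction" where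
  "projection A (Suc (Suc n)) 0 = WithL1 A (with_power A (Suc n)) (Ax A)"
| "projection A (Suc (Suc n)) (Suc i) = WithL2 A (with_power A (Suc n)) (projection A (Suc n) i)"
| "projection A n i = Ax A"

definition boolean :: "'a fm \<Rightarrow> nat \<Rightarrow> nat \<Rightarrow> 'a deduction" where
  "boolean A n i = LimpR (with_power A n) A (projection A n i)"

lemma church_body_proves:
  "proves (church_body A m) (replicate m (Bang (Limp A A)) @ [A]) A"
proof (induction m)
  case 0
  show ?case by (simp add: proves.intros)
next
  case (Suc m)
  from proves.intros(9)[OF Suc proves.intros(1)[of A]]
  show ?case by (simp add: proves.intros(11))
qed

lemma contract_proves:
  "proves p (replicate m (Bang A) @ \<Gamma>) B \<Longrightarrow> proves (contract A m p) (Bang A # \<Gamma>) B"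
  by (induction A m p rule: contract.induct) (auto intro: proves.intros)

lemma church_proves: "proves (church A m) [] (int_fm A)"
  unfolding church_def int_fm_def
  using contract_proves[OF church_body_proves[of A m]]
  by (intro proves.intros(10)) simp

lemma projection_proves: "proves (projection A n i) [with_power A n] A"
  by (induction A n i rule: projection.induct) (auto intro: proves.intros)

lemma boolean_proves: "proves (boolean A n i) [] (bool_fm n A)"
  unfolding boolean_def bool_fm_def
  by (intro proves.intros(10)) (simp add: projection_proves)

section \<open>Linear maps between subspaces\<close>

text \<open>All vector spaces are subspaces of an ambient vector space with scalar multiplication \<open>s\<close>;
  a map is only relevant on its domain.\<close>

definition linear_map_on ::
  "('k \<Rightarrow> 'v \<Rightarrow> 'v) \<Rightarrow> ('k \<Rightarrow> 'w \<Rightarrow> 'w) \<Rightarrow> 'v set \<Rightarrow> 'w set \<Rightarrow> ('v::ab_group_add \<Rightarrow> 'w::ab_group_add) \<Rightarrow> bool"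
  where
  "linear_map_on s t V W f \<longleftrightarrow>
     f ` V \<subseteq> W \<and>
     (\<forall>x\<in>V. \<forall>y\<in>V. f (x + y) = f x + f y) \<and>
     (\<forall>c. \<forall>x\<in>V. f (s c x) = t c (f x))"

definition multilinear_map_on ::
  "('k \<Rightarrow> 'v \<Rightarrow> 'v) \<Rightarrow> ('k \<Rightarrow> 'w \<Rightarrow> 'w) \<Rightarrow> 'v set list \<Rightarrow> 'w set \<Rightarrow> ('v::ab_group_add list \<Rightarrow> 'w::ab_group_add) \<Rightarrow> bool"
  where
  "multilinear_map_on s t Vs W f \<longleftrightarrow>
     f ` listset Vs \<subseteq> W \<and>
     (\<forall>xs\<in>listset Vs. \<forall>i<length Vs. linear_map_on s t (Vs ! i) W (\<lambda>x. f (xs[i := x])))"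

section \<open>Tensor products\<close>

text \<open>\<open>V\<^sub>1 \<otimes> \<dots> \<otimes> V\<^sub>n\<close> is the free vector space on \<open>V\<^sub>1 \<times> \<dots> \<times> V\<^sub>n\<close> modulo the subspace spanned by
  the multilinearity relations. An element of the tensor product is handled through
  a representative in the free space \<open>formal\<close>, and equality of elements is \<open>tensor_eq\<close>.\<close>

type_synonym ('k, 'v) ftens = "'v list \<Rightarrow>\<^sub>0 'k"

definition fscale :: "'k::comm_ring_1 \<Rightarrow> ('k, 'v) ftens \<Rightarrow> ('k, 'v) ftens" where
  "fscale c p = Poly_Mapping.map ((*) c) p"

abbreviation pure :: "'v list \<Rightarrow> ('k::comm_ring_1, 'v) ftens" where
  "pure xs \<equiv> Poly_Mapping.single xs 1"

definition formal :: "'v set list \<Rightarrow> ('k::comm_ring_1, 'v) ftens set" where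
  "formal Vs = {p. Poly_Mapping.keys p \<subseteq> listset Vs}"

definition tensor_relations ::
  "('k::field \<Rightarrow> 'v::ab_group_add \<Rightarrow> 'v) \<Rightarrow> 'v set list \<Rightarrow> ('k, 'v) ftens set" where
  "tensor_relations s Vs = module.span fscale
     ({pure (xs[i := x + y]) - pure (xs[i := x]) - pure (xs[i := y]) | xs i x y.
         xs \<in> listset Vs \<and> i < length Vs \<and> x \<in> Vs ! i \<and> y \<in> Vs ! i} \<union>
      {pure (xs[i := s c x]) - fscale c (pure (xs[i := x])) | xs i c x.
         xs \<in> listset Vs \<and> i < length Vs \<and> x \<in> Vs ! i})"

definition tensor_eq ::
  "('k::field \<Rightarrow> 'v::ab_group_add \<Rightarrow> 'v) \<Rightarrow> 'v set list \<Rightarrow> ('k, 'v) ftens \<Rightarrow> ('k, 'v) ftens \<Rightarrow> bool"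
  where
  "tensor_eq s Vs p q \<longleftrightarrow> p - q \<in> tensor_relations s Vs"

text \<open>Linear extension of a map on tuples. If \<open>f\<close> is multilinear, it induces the corresponding
  linear map on the tensor product.\<close>

definition lin_ext :: "('k::comm_ring_1 \<Rightarrow> 'w \<Rightarrow> 'w) \<Rightarrow> ('v list \<Rightarrow> 'w::ab_group_add) \<Rightarrow> ('k, 'v) ftens \<Rightarrow> 'w"
  where
  "lin_ext t f p = (\<Sum>xs\<in>Poly_Mapping.keys p. t (Poly_Mapping.lookup p xs) (f xs))"

definition ftensor :: "('k::comm_ring_1, 'v) ftens \<Rightarrow> ('k, 'v) ftens \<Rightarrow> ('k, 'v) ftens" where
  "ftensor p q = lin_ext fscale (\<lambda>xs. lin_ext fscale (\<lambda>ys. pure (xs @ ys)) q) p"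

definition is_tensor_product ::
  "('k::field \<Rightarrow> 'v::ab_group_add \<Rightarrow> 'v) \<Rightarrow> 'v set \<Rightarrow> 'v set \<Rightarrow> 'v set \<Rightarrow> ('v \<Rightarrow> 'v \<Rightarrow> 'v) \<Rightarrow> bool"
  where
  "is_tensor_product s V W T b \<longleftrightarrow>
     (let h = lin_ext s (\<lambda>xs. b (xs ! 0) (xs ! 1)) in
        h ` formal [V, W] = T \<and>
        (\<forall>p\<in>formal [V, W]. h p = 0 \<longleftrightarrow> p \<in> tensor_relations s [V, W]))"

section \<open>Coalgebras\<close>

definition is_cocomm_coalgebra ::
  "('k::field \<Rightarrow> 'v::ab_group_add \<Rightarrow> 'v) \<Rightarrow> 'v set \<Rightarrow> ('v \<Rightarrow> ('k, 'v) ftens) \<Rightarrow> ('v \<Rightarrow> 'k) \<Rightarrow> bool"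
  where
  "is_cocomm_coalgebra s C \<Delta> \<epsilon> \<longleftrightarrow>
     module.subspace s C \<and>
     (\<forall>x\<in>C. \<Delta> x \<in> formal [C, C]) \<and>
     (\<forall>x\<in>C. \<forall>y\<in>C. tensor_eq s [C, C] (\<Delta> (x + y)) (\<Delta> x + \<Delta> y)) \<and>
     (\<forall>c. \<forall>x\<in>C. tensor_eq s [C, C] (\<Delta> (s c x)) (fscale c (\<Delta> x))) \<and>
     linear_map_on s (*) C UNIV \<epsilon> \<and>
     (\<forall>z\<in>C. tensor_eq s [C, C, C]
        (lin_ext fscale (\<lambda>xs. ftensor (\<Delta> (xs ! 0)) (pure [xs ! 1])) (\<Delta> z))
        (lin_ext fscale (\<lambda>xs. ftensor (pure [xs ! 0]) (\<Delta> (xs ! 1))) (\<Delta> z))) \<and>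
     (\<forall>z\<in>C. lin_ext s (\<lambda>xs. s (\<epsilon> (xs ! 0)) (xs ! 1)) (\<Delta> z) = z) \<and>
     (\<forall>z\<in>C. lin_ext s (\<lambda>xs. s (\<epsilon> (xs ! 1)) (xs ! 0)) (\<Delta> z) = z) \<and>
     (\<forall>z\<in>C. tensor_eq s [C, C] (lin_ext fscale (\<lambda>xs. pure [xs ! 1, xs ! 0]) (\<Delta> z)) (\<Delta> z))"

definition is_coalgebra_morphism ::
  "('k::field \<Rightarrow> 'v::ab_group_add \<Rightarrow> 'v) \<Rightarrow>
   'v set \<Rightarrow> ('v \<Rightarrow> ('k, 'v) ftens) \<Rightarrow> ('v \<Rightarrow> 'k) \<Rightarrow>
   'v set \<Rightarrow> ('v \<Rightarrow> ('k, 'v) ftens) \<Rightarrow> ('v \<Rightarrow> 'k) \<Rightarrow> ('v \<Rightarrow> 'v) \<Rightarrow> bool"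
  where
  "is_coalgebra_morphism s C \<Delta> \<epsilon> C' \<Delta>' \<epsilon>' f \<longleftrightarrow>
     linear_map_on s s C C' f \<and>
     (\<forall>x\<in>C. tensor_eq s [C', C'] (\<Delta>' (f x)) (lin_ext fscale (\<lambda>xs. pure (map f xs)) (\<Delta> x))) \<and>
     (\<forall>x\<in>C. \<epsilon>' (f x) = \<epsilon> x)"

text \<open>The test coalgebras \<open>C\<close> are those carried by subspaces of the ambient space. This is no
  restriction over an infinite field: every coalgebra is the directed union of its
  finite-dimensional subcoalgebras, so finite-dimensional tests suffice, and an ambient space
  containing such an \<open>E\<close> for some \<open>V \<noteq> 0\<close> is infinite-dimensional, because already the
  one-dimensional tests put linearly independent group-like elements over all vectors of \<open>V\<close>
  into \<open>E\<close>.\<close>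

definition is_cofree_cocomm_coalgebra ::
  "('k::field \<Rightarrow> 'v::ab_group_add \<Rightarrow> 'v) \<Rightarrow> 'v set \<Rightarrow>
   'v set \<Rightarrow> ('v \<Rightarrow> ('k, 'v) ftens) \<Rightarrow> ('v \<Rightarrow> 'k) \<Rightarrow> ('v \<Rightarrow> 'v) \<Rightarrow> bool"
  where
  "is_cofree_cocomm_coalgebra s V E \<Delta> \<epsilon> d \<longleftrightarrow>
     is_cocomm_coalgebra s E \<Delta> \<epsilon> \<and>
     linear_map_on s s E V d \<and>
     (\<forall>C \<Delta>' \<epsilon>' \<phi>. is_cocomm_coalgebra s C \<Delta>' \<epsilon>' \<and> linear_map_on s s C V \<phi> \<longrightarrow>
        (\<exists>f. is_coalgebra_morphism s C \<Delta>' \<epsilon>' E \<Delta> \<epsilon> f \<and> (\<forall>x\<in>C. d (f x) = \<phi> x)) \<and>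
        (\<forall>f g. is_coalgebra_morphism s C \<Delta>' \<epsilon>' E \<Delta> \<epsilon> f \<and> (\<forall>x\<in>C. d (f x) = \<phi> x) \<and>
               is_coalgebra_morphism s C \<Delta>' \<epsilon>' E \<Delta> \<epsilon> g \<and> (\<forall>x\<in>C. d (g x) = \<phi> x) \<longrightarrow>
               (\<forall>x\<in>C. f x = g x)))"

section \<open>Sweedler semantics\<close>

text \<open>An interpretation chooses the space of each formula together with the structure maps that
  identify the space of a compound formula with the intended construction:
  \<open>tens A B a b\<close> is \<open>a \<otimes> b\<close>, \<open>app A B h\<close> is the map represented by the element \<open>h\<close> of
  \<open>Hom([[A]], [[B]])\<close>, and \<open>comul A\<close>, \<open>counit A\<close>, \<open>der A\<close> belong to \<open>![[A]]\<close>.\<close>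

record (overloaded) ('a, 'k::zero, 'v) interp =
  sem :: "'a fm \<Rightarrow> 'v set"
  tens :: "'a fm \<Rightarrow> 'a fm \<Rightarrow> 'v \<Rightarrow> 'v \<Rightarrow> 'v"
  proj1 :: "'a fm \<Rightarrow> 'a fm \<Rightarrow> 'v \<Rightarrow> 'v"
  proj2 :: "'a fm \<Rightarrow> 'a fm \<Rightarrow> 'v \<Rightarrow> 'v"
  app :: "'a fm \<Rightarrow> 'a fm \<Rightarrow> 'v \<Rightarrow> 'v \<Rightarrow> 'v"
  comul :: "'a fm \<Rightarrow> 'v \<Rightarrow> ('k, 'v) ftens"
  counit :: "'a fm \<Rightarrow> 'v \<Rightarrow> 'k"
  der :: "'a fm \<Rightarrow> 'v \<Rightarrow> 'v"

primrec subformulas :: "'a fm \<Rightarrow> 'a fm set" where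
  "subformulas (Atom a) = {Atom a}"
| "subformulas (Tensor A B) = insert (Tensor A B) (subformulas A \<union> subformulas B)"
| "subformulas (With A B) = insert (With A B) (subformulas A \<union> subformulas B)"
| "subformulas (Limp A B) = insert (Limp A B) (subformulas A \<union> subformulas B)"
| "subformulas (Bang A) = insert (Bang A) (subformulas A)"

text \<open>\<open>S\<close> is the set of formulas that are interpreted. It need not be the set of all formulas:
  iterating \<open>\<multimap>\<close> and \<open>!\<close> raises the dimension without bound, so that a single ambient space for
  all formulas may not exist in HOL, whereas one exists for the subformulas of any given formula.\<close>

definition sweedler_semantics ::
  "('k::field \<Rightarrow> 'v::ab_group_add \<Rightarrow> 'v) \<Rightarrow> 'a fm set \<Rightarrow> ('a, 'k, 'v) interp \<Rightarrow> bool"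
  where
  "sweedler_semantics s S I \<longleftrightarrow>
     vector_space s \<and>
     (\<forall>A\<in>S. subformulas A \<subseteq> S) \<and>
     (\<forall>A\<in>S. module.subspace s (sem I A)) \<and>
     (\<forall>A B. Tensor A B \<in> S \<longrightarrow>
        is_tensor_product s (sem I A) (sem I B) (sem I (Tensor A B)) (tens I A B)) \<and>
     (\<forall>A B. With A B \<in> S \<longrightarrow>
        linear_map_on s s (sem I (With A B)) (sem I A) (proj1 I A B) \<and>
        linear_map_on s s (sem I (With A B)) (sem I B) (proj2 I A B) \<and>
        bij_betw (\<lambda>z. (proj1 I A B z, proj2 I A B z)) (sem I (With A B)) (sem I A \<times> sem I B)) \<and>
     (\<forall>A B. Limp A B \<in> S \<longrightarrow>
        (\<forall>h\<in>sem I (Limp A B). linear_map_on s s (sem I A) (sem I B) (app I A B h)) \<and>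
        (\<forall>x\<in>sem I A. linear_map_on s s (sem I (Limp A B)) (sem I B) (\<lambda>h. app I A B h x)) \<and>
        (\<forall>f. linear_map_on s s (sem I A) (sem I B) f \<longrightarrow>
           (\<exists>!h. h \<in> sem I (Limp A B) \<and> (\<forall>x\<in>sem I A. app I A B h x = f x)))) \<and>
     (\<forall>A. Bang A \<in> S \<longrightarrow>
        is_cofree_cocomm_coalgebra s (sem I A) (sem I (Bang A)) (comul I A) (counit I A) (der I A))"

subsection \<open>Denotations of proofs\<close>

text \<open>A proof of \<open>A\<^sub>1, \<dots>, A\<^sub>n \<turnstile> B\<close> denotes a linear map from the tensor product of the \<open>[[A\<^sub>i]]\<close> to
  \<open>[[B]]\<close>, given here as a multilinear map on lists; for \<open>n = 0\<close> this is the element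
  \<open>den s I p []\<close> of \<open>[[B]]\<close>.

  \<open>is_promotion\<close> says that \<open>F\<close> is a morphism of coalgebras from
  \<open>![[A\<^sub>1]] \<otimes> \<dots> \<otimes> ![[A\<^sub>n]]\<close> to \<open>![[B]]\<close> lifting \<open>f\<close>. The comultiplication of the tensor product of
  coalgebras is the tensor product of the comultiplications followed by the permutation that
  collects the factors in even and in odd positions.\<close>

definition is_promotion ::
  "('k::field \<Rightarrow> 'v::ab_group_add \<Rightarrow> 'v) \<Rightarrow> ('a, 'k, 'v) interp \<Rightarrow> 'a fm list \<Rightarrow> 'a fm \<Rightarrow>
   ('v list \<Rightarrow> 'v) \<Rightarrow> ('v list \<Rightarrow> 'v) \<Rightarrow> bool"
  where
  "is_promotion s I \<Gamma> B f F \<longleftrightarrow>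
     (let n = length \<Gamma>; Vs = map (\<lambda>A. sem I (Bang A)) \<Gamma>; E = sem I (Bang B) in
        multilinear_map_on s s Vs E F \<and>
        (\<forall>xs\<in>listset Vs.
           tensor_eq s [E, E] (comul I B (F xs))
             (lin_ext fscale
                (\<lambda>ys. pure [F (map (\<lambda>i. ys ! (2 * i)) [0..<n]),
                             F (map (\<lambda>i. ys ! (2 * i + 1)) [0..<n])])
                (foldr ftensor (map2 (comul I) \<Gamma> xs) (pure []))) \<and>
           counit I B (F xs) = prod_list (map2 (counit I) \<Gamma> xs) \<and>
           der I B (F xs) = f xs))"

primrec den ::
  "('k::field \<Rightarrow> 'v::ab_group_add \<Rightarrow> 'v) \<Rightarrow> ('a, 'k, 'v) interp \<Rightarrow> 'a deduction \<Rightarrow> 'v list \<Rightarrow> 'v"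
  where
  "den s I (Ax A) = (\<lambda>zs. hd zs)"
| "den s I (Cut \<Gamma> p q) = (\<lambda>zs.
     den s I q (den s I p (take (length \<Gamma>) zs) # drop (length \<Gamma>) zs))"
| "den s I (Exch \<Gamma> p) = (\<lambda>zs. let n = length \<Gamma> in
     den s I p (zs[n := zs ! Suc n, Suc n := zs ! n]))"
| "den s I (TensorL A B p) = (\<lambda>zs.
     lin_ext s (\<lambda>xs. den s I p (xs @ tl zs))
       (SOME t. t \<in> formal [sem I A, sem I B] \<and>
                lin_ext s (\<lambda>xs. tens I A B (xs ! 0) (xs ! 1)) t = hd zs))"
| "den s I (TensorR \<Gamma> A B p q) = (\<lambda>zs.
     tens I A B (den s I p (take (length \<Gamma>) zs)) (den s I q (drop (length \<Gamma>) zs)))"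
| "den s I (WithL1 A B p) = (\<lambda>zs. den s I p (proj1 I A B (hd zs) # tl zs))"
| "den s I (WithL2 A B p) = (\<lambda>zs. den s I p (proj2 I A B (hd zs) # tl zs))"
| "den s I (WithR A B p q) = (\<lambda>zs.
     THE z. z \<in> sem I (With A B) \<and> proj1 I A B z = den s I p zs \<and> proj2 I A B z = den s I q zs)"
| "den s I (LimpL \<Gamma> A B p q) = (\<lambda>zs.
     den s I q (app I A B (hd zs) (den s I p (take (length \<Gamma>) (tl zs)))
                 # drop (length \<Gamma>) (tl zs)))"
| "den s I (LimpR A B p) = (\<lambda>zs.
     THE h. h \<in> sem I (Limp A B) \<and> (\<forall>x\<in>sem I A. app I A B h x = den s I p (zs @ [x])))"
| "den s I (Der A p) = (\<lambda>zs. den s I p (der I A (hd zs) # tl zs))"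
| "den s I (Contr A p) = (\<lambda>zs. lin_ext s (\<lambda>xs. den s I p (xs @ tl zs)) (comul I A (hd zs)))"
| "den s I (Weak A p) = (\<lambda>zs. s (counit I A (hd zs)) (den s I p (tl zs)))"
| "den s I (Prom \<Gamma> A p) = (SOME F. is_promotion s I \<Gamma> A (den s I p) F)"

section \<open>Linear independence\<close>

text \<open>Independence of a family: distinct indices give distinct vectors.\<close>

definition independent_family_in ::
  "('k::field \<Rightarrow> 'v::ab_group_add \<Rightarrow> 'v) \<Rightarrow> 'v set \<Rightarrow> 'i set \<Rightarrow> ('i \<Rightarrow> 'v) \<Rightarrow> bool"
  where
  "independent_family_in s V J f \<longleftrightarrow>
     f ` J \<subseteq> V \<and> inj_on f J \<and> module.independent s (f ` J)"

text \<open>Positive (possibly infinite) dimension; \<open>dim\<close> of the library is \<open>0\<close> for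
  infinite-dimensional spaces.\<close>

definition positive_dim :: "('k::field \<Rightarrow> 'v::ab_group_add \<Rightarrow> 'v) \<Rightarrow> 'v set \<Rightarrow> bool" where
  "positive_dim s V \<longleftrightarrow> (\<exists>B. module.independent s B \<and> module.span s B = V \<and> B \<noteq> {})"

end

(* Evaluating a numeral at the group-like element over c * id turns [[m]] into c^m * id, and k
   is infinite, so a linear relation between numerals would be a nonzero polynomial vanishing
   on all of k.  Group-like elements are the lifts of maps out of one-dimensional coalgebras.
   Booleans are separated by the tuples with a single nonzero entry. *)
theory Submission
  imports Defs
begin

section \<open>Linear and multilinear maps\<close>

text \<open>\<open>comul\<close> returns only a representative in the free space on pairs, so at a
  group-like \<open>e\<close> it is related to \<open>pure [e, e]\<close> by
  \<open>tensor_eq\<close> and need not equal it. Exchanging the two under \<open>lin_ext\<close>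
  requires the denotation that follows to be multilinear. Likewise, the \<open>THE\<close> in the
  clause for \<open>LimpR\<close> picks the intended element only if the body is linear in the
  abstracted variable. For these two reasons most of the work is multilinearity, shown for the rules
  from which numerals and booleans are built. Scalar endomorphisms suffice because their powers send
  a fixed vector \<open>a\<close> to multiples of \<open>a\<close>: a relation between numerals
  becomes one between scalars.\<close>

lemma linear_map_onD:
  assumes "linear_map_on s t V W f"
  shows "x \<in> V \<Longrightarrow> f x \<in> W"
    and "x \<in> V \<Longrightarrow> y \<in> V \<Longrightarrow> f (x + y) = f x + f y"
    and "x \<in> V \<Longrightarrow> f (s c x) = t c (f x)"
  using assms unfolding linear_map_on_def by auto

lemma linear_map_onI:
  assumes "\<And>x. x \<in> V \<Longrightarrow> f x \<in> W"
    and "\<And>x y. x \<in> V \<Longrightarrow> y \<in> V \<Longrightarrow> f (x + y) = f x + f y"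
    and "\<And>c x. x \<in> V \<Longrightarrow> f (s c x) = t c (f x)"
  shows "linear_map_on s t V W f"
  using assms unfolding linear_map_on_def by auto

text \<open>Agreement on \<open>V\<close> transfers linearity because a subspace also contains
  \<open>x + y\<close> and \<open>s c x\<close>.\<close>

lemma linear_map_on_cong:
  assumes "module.subspace s V" "module s"
    and "linear_map_on s t V W f" "\<And>x. x \<in> V \<Longrightarrow> f x = g x"
  shows "linear_map_on s t V W g"
proof -
  interpret module s by fact
  show ?thesis
    using assms(3) subspace_add[OF assms(1)] subspace_scale[OF assms(1)]
    by (auto simp: linear_map_on_def simp flip: assms(4))
qed

lemma linear_map_on_compose:
  assumes "linear_map_on s t U V f" "linear_map_on t u V W g"
  shows "linear_map_on s u U W (\<lambda>x. g (f x))"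
  using assms by (auto simp: linear_map_on_def image_subset_iff)

lemma listset_iff: "xs \<in> listset Vs \<longleftrightarrow> list_all2 (\<in>) xs Vs"
  by (induction Vs arbitrary: xs) (auto simp: set_Cons_def list_all2_Cons2)

lemma listset_update:
  "xs \<in> listset Vs \<Longrightarrow> i < length Vs \<Longrightarrow> x \<in> Vs ! i \<Longrightarrow> xs[i := x] \<in> listset Vs"
  by (auto simp: listset_iff list_all2_conv_all_nth nth_list_update)

lemma listset_length: "xs \<in> listset Vs \<Longrightarrow> length xs = length Vs"
  by (auto simp: listset_iff dest: list_all2_lengthD)

lemma listset_append: "xs \<in> listset Us \<Longrightarrow> ys \<in> listset Vs \<Longrightarrow> xs @ ys \<in> listset (Us @ Vs)"
  by (auto simp: listset_iff intro: list_all2_appendI)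

lemma listset_ConsE:
  assumes "zs \<in> listset (V # Vs)"
  obtains x xs where "zs = x # xs" "x \<in> V" "xs \<in> listset Vs"
  using assms by (auto simp: set_Cons_def)

lemma multilinear_map_on_in:
  "multilinear_map_on s t Vs W f \<Longrightarrow> xs \<in> listset Vs \<Longrightarrow> f xs \<in> W"
  by (auto simp: multilinear_map_on_def)

lemma multilinear_map_on_linear:
  "multilinear_map_on s t Vs W f \<Longrightarrow> xs \<in> listset Vs \<Longrightarrow> i < length Vs \<Longrightarrow>
     linear_map_on s t (Vs ! i) W (\<lambda>x. f (xs[i := x]))"
  by (auto simp: multilinear_map_on_def)

text \<open>Slot 0 and the later slots are treated separately, which matches the way contexts grow
  at the head.\<close>

lemma multilinear_map_on_ConsI:
  assumes "\<And>xs. xs \<in> listset Vs \<Longrightarrow> linear_map_on s t V W (\<lambda>x. f (x # xs))"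
    and "\<And>x. x \<in> V \<Longrightarrow> multilinear_map_on s t Vs W (\<lambda>xs. f (x # xs))"
  shows "multilinear_map_on s t (V # Vs) W f"
  unfolding multilinear_map_on_def
proof (intro conjI ballI allI impI subsetI)
  fix y assume "y \<in> f ` listset (V # Vs)"
  then obtain zs where "zs \<in> listset (V # Vs)" "y = f zs" by blast
  then show "y \<in> W"
    using multilinear_map_on_in[OF assms(2)] by (metis listset_ConsE)
next
  fix zs i assume zs: "zs \<in> listset (V # Vs)" and i: "i < length (V # Vs)"
  from zs obtain x xs where x: "zs = x # xs" "x \<in> V" "xs \<in> listset Vs"
    by (rule listset_ConsE)
  show "linear_map_on s t ((V # Vs) ! i) W (\<lambda>x. f (zs[i := x]))"
    using i x assms(1) multilinear_map_on_linear[OF assms(2)] by (cases i) auto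
qed

lemma multilinear_map_on_appendD1:
  assumes f: "multilinear_map_on s t (Us @ Vs) W f" and ys: "ys \<in> listset Vs"
  shows "multilinear_map_on s t Us W (\<lambda>xs. f (xs @ ys))"
  unfolding multilinear_map_on_def
proof (intro conjI ballI allI impI)
  show "(\<lambda>xs. f (xs @ ys)) ` listset Us \<subseteq> W"
    using multilinear_map_on_in[OF f] listset_append[OF _ ys] by auto
  fix xs i assume xs: "xs \<in> listset Us" and i: "i < length Us"
  then show "linear_map_on s t (Us ! i) W (\<lambda>x. f (xs[i := x] @ ys))"
    using multilinear_map_on_linear[OF f listset_append[OF xs ys], of i] listset_length[OF xs]
    by (simp add: nth_append list_update_append)
qed

lemma multilinear_map_on_appendD2:
  assumes f: "multilinear_map_on s t (Us @ Vs) W f" and xs: "xs \<in> listset Us"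
  shows "multilinear_map_on s t Vs W (\<lambda>ys. f (xs @ ys))"
  unfolding multilinear_map_on_def
proof (intro conjI ballI allI impI)
  show "(\<lambda>ys. f (xs @ ys)) ` listset Vs \<subseteq> W"
    using multilinear_map_on_in[OF f] listset_append[OF xs] by auto
  fix ys i assume ys: "ys \<in> listset Vs" and i: "i < length Vs"
  then show "linear_map_on s t (Vs ! i) W (\<lambda>x. f (xs @ ys[i := x]))"
    using multilinear_map_on_linear[OF f listset_append[OF xs ys], of "length Us + i"]
      listset_length[OF xs]
    by (simp add: nth_append list_update_append)
qed

lemma multilinear_map_on_ConsD:
  assumes "multilinear_map_on s t (V # Vs) W f"
  shows "x \<in> V \<Longrightarrow> multilinear_map_on s t Vs W (\<lambda>xs. f (x # xs))"
  using multilinear_map_on_appendD2[of s t "[V]" Vs W f "[x]"] assms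
  by (simp add: set_Cons_def)

lemma multilinear_map_on_ConsD':
  assumes "multilinear_map_on s t (V # Vs) W f" "V \<noteq> {}" "xs \<in> listset Vs"
  shows "linear_map_on s t V W (\<lambda>x. f (x # xs))"
proof -
  \<comment> \<open>Linearity in a slot is stated at a complete tuple, so the head needs some
    inhabitant \<open>x0\<close>, which the update then overwrites.\<close>
  from assms(2) obtain x0 where "x0 \<in> V" by blast
  then show ?thesis
    using multilinear_map_on_linear[OF assms(1), of "x0 # xs" 0] assms(3)
    by (simp add: set_Cons_def)
qed

lemma multilinear_map_on_cong:
  assumes "multilinear_map_on s t Vs W f" "\<And>xs. xs \<in> listset Vs \<Longrightarrow> f xs = g xs"
    and "\<And>V. V \<in> set Vs \<Longrightarrow> module.subspace s V" "module s"
  shows "multilinear_map_on s t Vs W g"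
  unfolding multilinear_map_on_def
proof (intro conjI ballI allI impI)
  show "g ` listset Vs \<subseteq> W"
    using assms(1,2) by (auto simp: multilinear_map_on_def image_subset_iff)
  fix xs i assume "xs \<in> listset Vs" "i < length Vs"
  then show "linear_map_on s t (Vs ! i) W (\<lambda>x. g (xs[i := x]))"
    by (intro linear_map_on_cong[OF _ assms(4) multilinear_map_on_linear[OF assms(1)]])
      (auto simp: assms listset_update)
qed

section \<open>Linear combinations and linear independence\<close>

context vector_space
begin

lemma linear_map_on_sum:
  assumes "linear_map_on scale scale V W f" "subspace V" "\<And>j. j \<in> J \<Longrightarrow> g j \<in> V" "finite J"
  shows "f (\<Sum>j\<in>J. c j *s g j) = (\<Sum>j\<in>J. c j *s f (g j))"
  using assms(4,3)
proof (induction J rule: finite_induct)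
  case empty
  \<comment> \<open>\<open>f\<close> is linear only on \<open>V\<close>, so \<open>f 0 = 0\<close>
    comes from scaling the vector 0 of \<open>V\<close> by the scalar 0.\<close>
  have "f (0 *s 0) = 0 *s f 0"
    by (rule linear_map_onD(3)[OF assms(1)]) (use assms(2) subspace_0 in blast)
  then show ?case by simp
next
  case (insert j J)
  have "(\<Sum>j\<in>J. c j *s g j) \<in> V" "c j *s g j \<in> V"
    using insert.prems assms(2) by (auto intro!: subspace_sum subspace_scale)
  then show ?case
    using insert linear_map_onD[OF assms(1)] by simp
qed

lemma linear_map_on_lincomb:
  assumes "subspace W" "finite J" "\<And>j. j \<in> J \<Longrightarrow> linear_map_on t scale V W (f j)"
  shows "linear_map_on t scale V W (\<lambda>x. \<Sum>j\<in>J. c j *s f j x)"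
proof (rule linear_map_onI)
  show "(\<Sum>j\<in>J. c j *s f j x) \<in> W" if "x \<in> V" for x
    using that linear_map_onD(1)[OF assms(3)] assms(1) by (auto intro!: subspace_sum subspace_scale)
  show "(\<Sum>j\<in>J. c j *s f j (x + y)) = (\<Sum>j\<in>J. c j *s f j x) + (\<Sum>j\<in>J. c j *s f j y)"
    if "x \<in> V" "y \<in> V" for x y
    using that linear_map_onD(2)[OF assms(3)]
    by (simp add: scale_right_distrib flip: sum.distrib)
  show "(\<Sum>j\<in>J. c j *s f j (t a x)) = a *s (\<Sum>j\<in>J. c j *s f j x)" if "x \<in> V" for a x
    using that linear_map_onD(3)[OF assms(3)]
    by (simp add: scale_sum_right mult.commute)
qed

text \<open>Serves contraction, as a sum over the support of a comultiplication, and weakening, as a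
  single scaled term.\<close>

lemma multilinear_map_on_lincomb:
  assumes "subspace W" "finite J" "\<And>j. j \<in> J \<Longrightarrow> multilinear_map_on t scale Vs W (f j)"
  shows "multilinear_map_on t scale Vs W (\<lambda>xs. \<Sum>j\<in>J. c j *s f j xs)"
  unfolding multilinear_map_on_def
proof (intro conjI ballI allI impI)
  show "(\<lambda>xs. \<Sum>j\<in>J. c j *s f j xs) ` listset Vs \<subseteq> W"
    using multilinear_map_on_in[OF assms(3)] assms(1)
    by (auto intro!: subspace_sum subspace_scale)
  show "linear_map_on t scale (Vs ! i) W (\<lambda>x. \<Sum>j\<in>J. c j *s f j (xs[i := x]))"
    if "xs \<in> listset Vs" "i < length Vs" for xs i
    by (intro linear_map_on_lincomb[OF assms(1,2)] multilinear_map_on_linear[OF assms(3)] that)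
qed

text \<open>With coefficients indexed by \<open>J\<close> rather than by vectors, one condition
  excludes repeated vectors as well as linear relations.\<close>

lemma independent_family_inI:
  assumes "\<And>j. j \<in> J \<Longrightarrow> f j \<in> V"
    and indep: "\<And>T c j. finite T \<Longrightarrow> T \<subseteq> J \<Longrightarrow> (\<Sum>j\<in>T. c j *s f j) = 0 \<Longrightarrow> j \<in> T \<Longrightarrow> c j = 0"
  shows "independent_family_in scale V J f"
  unfolding independent_family_in_def
proof (intro conjI)
  show "f ` J \<subseteq> V" using assms(1) by blast
  show "inj_on f J"
  proof (rule inj_onI, rule ccontr)
    fix i j assume ij: "i \<in> J" "j \<in> J" "f i = f j" "i \<noteq> j"
    \<comment> \<open>A repeated vector would give the relation \<open>f i - f j = 0\<close>, whose
      coefficients are 1 and -1.\<close>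
    then have "(\<Sum>l\<in>{i, j}. (if l = i then 1 else - 1) *s f l) = 0" by simp
    from indep[OF _ _ this, of i] ij show False by simp
  qed
  show "independent (f ` J)"
    unfolding independent_explicit_module
  proof (intro allI impI)
    fix T u v assume T: "finite T" "T \<subseteq> f ` J" "(\<Sum>v\<in>T. u v *s v) = 0" "v \<in> T"
    \<comment> \<open>One index is chosen for each vector of \<open>T\<close>, so that the sum over
      \<open>T\<close> can be reindexed.\<close>
    then obtain R where R: "R \<subseteq> J" "inj_on f R" "T = f ` R"
      unfolding subset_image_inj by blast
    with T have "(\<Sum>j\<in>R. u (f j) *s f j) = 0" "finite R"
      by (auto simp: sum.reindex dest: finite_imageD)
    with indep[of R "\<lambda>j. u (f j)"] R T(4) show "u v = 0" by blast
  qed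
qed

end

section \<open>Polynomial functions over an algebraically closed field\<close>

lemma alg_closed_field_infinite: "infinite (UNIV :: 'k::alg_closed_field set)"
proof
  assume fin: "finite (UNIV :: 'k set)"
  \<comment> \<open>Over a finite field \<open>p\<close> vanishes everywhere, so
    \<open>p + 1\<close> would be a nonconstant polynomial without a root.\<close>
  define p :: "'k poly" where "p = (\<Prod>a\<in>UNIV. [:- a, 1:])"
  have root: "poly p x = 0" for x
    using fin by (auto simp: p_def poly_prod)
  have "degree p = card (UNIV :: 'k set)"
    unfolding p_def by (subst degree_prod_eq_sum_degree) auto
  then have "degree p > 0"
    using finite_UNIV_card_ge_0[OF fin] by simp
  then have "degree (p + 1) > 0"
    by (simp add: degree_add_eq_left)
  then obtain x where "poly (p + 1) x = 0"
    using alg_closed_imp_poly_has_root by blast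
  then show False using root by simp
qed

text \<open>A polynomial with infinitely many roots is zero, and distinct exponents make each
  \<open>c m\<close> one of its coefficients.\<close>

lemma finite_power_sum_vanishes:
  fixes c :: "nat \<Rightarrow> 'k::alg_closed_field"
  assumes "finite T" "\<And>x. (\<Sum>m\<in>T. c m * x ^ m) = 0" "m \<in> T"
  shows "c m = 0"
proof -
  define p where "p = (\<Sum>m\<in>T. monom (c m) m)"
  have "poly p x = 0" for x
    using assms(2) by (simp add: p_def poly_sum poly_monom)
  then have "p = 0"
    using poly_roots_finite[of p] alg_closed_field_infinite by auto
  moreover have "coeff p m = c m"
    using assms(1,3) by (simp add: p_def coeff_sum)
  ultimately show ?thesis by simp
qed

section \<open>Formal tensors\<close>

lemma lookup_fscale: "Poly_Mapping.lookup (fscale c p) xs = c * Poly_Mapping.lookup p xs"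
  unfolding fscale_def by transfer (simp add: when_def)

lemma module_fscale: "module (fscale :: 'k::comm_ring_1 \<Rightarrow> ('k, 'v) ftens \<Rightarrow> _)"
  by unfold_locales
    (auto intro!: poly_mapping_eqI simp: lookup_fscale lookup_add algebra_simps)

lemma fscale_single: "fscale c (Poly_Mapping.single xs d) = Poly_Mapping.single xs (c * d)"
  by (rule poly_mapping_eqI) (simp add: lookup_fscale lookup_single when_def)

lemma tensor_eq_refl: "tensor_eq s Vs p p"
proof -
  interpret module fscale by (rule module_fscale)
  show ?thesis by (simp add: tensor_eq_def tensor_relations_def span_zero)
qed

section \<open>Linear extension and the relations of the tensor product\<close>

context module
begin

text \<open>Addition and scaling can shrink supports by cancellation, so sums are compared over a
  common finite superset.\<close>

lemma lin_ext_superset: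
  assumes "finite F" "Poly_Mapping.keys p \<subseteq> F"
  shows "lin_ext scale f p = (\<Sum>xs\<in>F. Poly_Mapping.lookup p xs *s f xs)"
  unfolding lin_ext_def using assms
  by (intro sum.mono_neutral_left) (auto simp: in_keys_iff)

lemma lin_ext_single: "lin_ext scale f (Poly_Mapping.single xs c) = c *s f xs"
  by (subst lin_ext_superset[of "{xs}"]) auto

lemma lin_ext_add: "lin_ext scale f (p + q) = lin_ext scale f p + lin_ext scale f q"
proof -
  let ?F = "Poly_Mapping.keys p \<union> Poly_Mapping.keys q"
  have "Poly_Mapping.keys (p + q) \<subseteq> ?F" by (rule keys_add)
  then show ?thesis
    by (simp add: lin_ext_superset[of ?F] lookup_add scale_left_distrib sum.distrib)
qed

lemma lin_ext_fscale: "lin_ext scale f (fscale c p) = c *s lin_ext scale f p"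
proof -
  have "Poly_Mapping.keys (fscale c p) \<subseteq> Poly_Mapping.keys p"
    by (auto simp: in_keys_iff lookup_fscale)
  then show ?thesis
    by (simp add: lin_ext_superset[of "Poly_Mapping.keys p"] lookup_fscale scale_sum_right)
qed

lemma lin_ext_diff: "lin_ext scale f (p - q) = lin_ext scale f p - lin_ext scale f q"
  using lin_ext_add[of f "p - q" q] by simp

end

lemma ftensor_single:
  "ftensor (Poly_Mapping.single xs c) (Poly_Mapping.single ys d) =
     Poly_Mapping.single (xs @ ys) (c * d)"
proof -
  interpret module fscale by (rule module_fscale)
  show ?thesis by (simp add: ftensor_def lin_ext_single fscale_single)
qed

context vector_space
begin

text \<open>Each generator of the relations records additivity or homogeneity in one slot, which
  \<open>f\<close> respects; linearity of \<open>lin_ext\<close> extends this to the span. Hence a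
  multilinear map descends to the tensor product.\<close>

lemma lin_ext_tensor_relations:
  assumes f: "multilinear_map_on scale scale Vs W f" and p: "p \<in> tensor_relations scale Vs"
  shows "lin_ext scale f p = 0"
proof -
  interpret F: module "fscale :: 'a \<Rightarrow> ('a, 'b) ftens \<Rightarrow> _" by (rule module_fscale)
  from p show ?thesis
    unfolding tensor_relations_def
  proof (induction rule: F.span_induct_alt)
    case base
    show ?case by (simp add: lin_ext_def)
  next
    case (step c x y)
    have "lin_ext scale f x = 0"
      using step(1)
    proof (elim UnE CollectE exE conjE)
      fix xs i u v
      assume "x = pure (xs[i := u + v]) - pure (xs[i := u]) - pure (xs[i := v])"
        "xs \<in> listset Vs" "i < length Vs" "u \<in> Vs ! i" "v \<in> Vs ! i"
      then show ?thesis
        using linear_map_onD(2)[OF multilinear_map_on_linear[OF f]]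
        by (simp add: lin_ext_diff lin_ext_single)
    next
      fix xs i a u
      assume "x = pure (xs[i := a *s u]) - fscale a (pure (xs[i := u]))"
        "xs \<in> listset Vs" "i < length Vs" "u \<in> Vs ! i"
      then show ?thesis
        using linear_map_onD(3)[OF multilinear_map_on_linear[OF f]]
        by (simp add: lin_ext_diff lin_ext_single lin_ext_fscale)
    qed
    with step(2) show ?case by (simp add: lin_ext_add lin_ext_fscale)
  qed
qed

lemma lin_ext_tensor_eq:
  assumes "multilinear_map_on scale scale Vs W f" "tensor_eq scale Vs p q"
  shows "lin_ext scale f p = lin_ext scale f q"
  using lin_ext_tensor_relations[OF assms(1)] assms(2) lin_ext_diff[of f p q]
  by (simp add: tensor_eq_def)

section \<open>Group-like elements\<close>

text \<open>On the line through \<open>v\<close>, with \<open>v\<close> made group-like,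
  \<open>\<epsilon>\<close> is the coordinate along \<open>v\<close>, unique because
  \<open>v\<close> is nonzero. The laws stated up to \<open>tensor_eq\<close> hold already as
  equalities of formal tensors.\<close>

lemma line_coalgebra:
  assumes v: "v \<noteq> 0"
  defines "C \<equiv> range (\<lambda>c. c *s v)"
  defines "\<epsilon> \<equiv> \<lambda>x. THE c. x = c *s v"
  shows "is_cocomm_coalgebra scale C (\<lambda>x. Poly_Mapping.single [v, v] (\<epsilon> x)) \<epsilon>"
    and "\<epsilon> v = 1"
proof -
  interpret F: module "fscale :: 'a \<Rightarrow> ('a, 'b) ftens \<Rightarrow> _" by (rule module_fscale)
  have \<epsilon>: "\<epsilon> (c *s v) = c" for c
    using v by (auto simp: \<epsilon>_def)
  show \<epsilon>v: "\<epsilon> v = 1" using \<epsilon>[of 1] by simp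
  have add: "c *s v + d *s v = (c + d) *s v" for c d
    by (simp add: scale_left_distrib)
  have vC: "v \<in> C"
    unfolding C_def by (rule range_eqI[of _ _ 1]) simp
  have sub: "subspace C"
    unfolding C_def subspace_def using add by (auto intro: range_eqI[of _ _ 0])
  have lin: "linear_map_on scale (*) C UNIV \<epsilon>"
    unfolding C_def by (rule linear_map_onI) (auto simp: add \<epsilon> simp del: scale_left_distrib)
  show "is_cocomm_coalgebra scale C (\<lambda>x. Poly_Mapping.single [v, v] (\<epsilon> x)) \<epsilon>"
    unfolding is_cocomm_coalgebra_def
  proof (intro conjI ballI allI sub lin)
    fix x y assume "x \<in> C" "y \<in> C"
    then show "tensor_eq scale [C, C] (Poly_Mapping.single [v, v] (\<epsilon> (x + y)))
      (Poly_Mapping.single [v, v] (\<epsilon> x) + Poly_Mapping.single [v, v] (\<epsilon> y))"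
      by (simp add: linear_map_onD(2)[OF lin] single_add tensor_eq_refl)
  next
    fix c x assume "x \<in> C"
    then show "tensor_eq scale [C, C] (Poly_Mapping.single [v, v] (\<epsilon> (c *s x)))
      (fscale c (Poly_Mapping.single [v, v] (\<epsilon> x)))"
      by (simp add: linear_map_onD(3)[OF lin] fscale_single tensor_eq_refl)
  next
    fix x assume "x \<in> C"
    then obtain c where x: "x = c *s v" by (auto simp: C_def)
    show "Poly_Mapping.single [v, v] (\<epsilon> x) \<in> formal [C, C]"
      using vC by (auto simp: formal_def set_Cons_def)
    show "tensor_eq scale [C, C, C]
      (lin_ext fscale (\<lambda>xs. ftensor (Poly_Mapping.single [v, v] (\<epsilon> (xs ! 0))) (pure [xs ! 1]))
        (Poly_Mapping.single [v, v] (\<epsilon> x)))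
      (lin_ext fscale (\<lambda>xs. ftensor (pure [xs ! 0]) (Poly_Mapping.single [v, v] (\<epsilon> (xs ! 1))))
        (Poly_Mapping.single [v, v] (\<epsilon> x)))"
      by (simp add: F.lin_ext_single ftensor_single tensor_eq_refl)
    show "lin_ext scale (\<lambda>xs. \<epsilon> (xs ! 0) *s xs ! 1) (Poly_Mapping.single [v, v] (\<epsilon> x)) = x"
      "lin_ext scale (\<lambda>xs. \<epsilon> (xs ! 1) *s xs ! 0) (Poly_Mapping.single [v, v] (\<epsilon> x)) = x"
      by (simp_all add: lin_ext_single x \<epsilon> \<epsilon>v)
    show "tensor_eq scale [C, C]
      (lin_ext fscale (\<lambda>xs. pure [xs ! 1, xs ! 0]) (Poly_Mapping.single [v, v] (\<epsilon> x)))
      (Poly_Mapping.single [v, v] (\<epsilon> x))"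
      by (simp add: F.lin_ext_single fscale_single tensor_eq_refl)
  qed
qed

lemma cofree_lift:
  assumes "is_cofree_cocomm_coalgebra scale V E \<Delta> \<epsilon> d"
    and "is_cocomm_coalgebra scale C \<Delta>' \<epsilon>'" "linear_map_on scale scale C V \<phi>"
  obtains f where "is_coalgebra_morphism scale C \<Delta>' \<epsilon>' E \<Delta> \<epsilon> f" "\<forall>x\<in>C. d (f x) = \<phi> x"
  using assms unfolding is_cofree_cocomm_coalgebra_def by blast

text \<open>Coalgebra morphisms preserve group-like elements, so the lift of the linear map taking
  \<open>v\<close> to \<open>h\<close> sends \<open>v\<close> to a group-like element over
  \<open>h\<close>. The line is spanned by an arbitrary nonzero ambient vector and not by
  \<open>h\<close>, because \<open>h\<close> may be 0.\<close>

lemma grouplike_exists: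
  assumes cofree: "is_cofree_cocomm_coalgebra scale V E \<Delta> \<epsilon> d" and V: "subspace V" and h: "h \<in> V"
    and v: "(v :: 'b) \<noteq> 0"
  obtains e where "e \<in> E" "tensor_eq scale [E, E] (\<Delta> e) (pure [e, e])" "\<epsilon> e = 1" "d e = h"
proof -
  interpret F: module "fscale :: 'a \<Rightarrow> ('a, 'b) ftens \<Rightarrow> _" by (rule module_fscale)
  let ?C = "range (\<lambda>c. c *s v)" and ?\<eta> = "\<lambda>x. THE c. x = c *s v"
  let ?D = "\<lambda>x. Poly_Mapping.single [v, v] (?\<eta> x)"
  note C = line_coalgebra[OF v]
  have vC: "v \<in> ?C" by (rule range_eqI[of _ _ 1]) simp
  have \<eta>: "linear_map_on scale (*) ?C UNIV ?\<eta>"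
    using C(1) by (simp add: is_cocomm_coalgebra_def)
  have "linear_map_on scale scale ?C V (\<lambda>x. ?\<eta> x *s h)"
  proof (rule linear_map_onI)
    show "?\<eta> x *s h \<in> V" for x
      by (rule subspace_scale[OF V h])
    show "?\<eta> (x + y) *s h = ?\<eta> x *s h + ?\<eta> y *s h" if "x \<in> ?C" "y \<in> ?C" for x y
      by (simp only: linear_map_onD(2)[OF \<eta> that] scale_left_distrib)
    show "?\<eta> (c *s x) *s h = c *s ?\<eta> x *s h" if "x \<in> ?C" for c x
      by (simp only: linear_map_onD(3)[OF \<eta> that] scale_scale)
  qed
  then obtain f where f: "is_coalgebra_morphism scale ?C ?D ?\<eta> E \<Delta> \<epsilon> f"
    and d: "\<forall>x\<in>?C. d (f x) = ?\<eta> x *s h"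
    by (rule cofree_lift[OF cofree C(1)])
  show thesis
  proof
    show "f v \<in> E"
      using f vC by (auto simp only: is_coalgebra_morphism_def dest: linear_map_onD(1))
    have "tensor_eq scale [E, E] (\<Delta> (f v)) (lin_ext fscale (\<lambda>xs. pure (map f xs)) (?D v))"
      using f vC by (simp only: is_coalgebra_morphism_def)
    then show "tensor_eq scale [E, E] (\<Delta> (f v)) (pure [f v, f v])"
      by (simp only: C(2) F.lin_ext_single fscale_single list.map mult_1)
    show "\<epsilon> (f v) = 1"
      using f vC C(2) by (simp only: is_coalgebra_morphism_def)
    show "d (f v) = h"
      using d vC C(2) by (simp only: scale_one)
  qed
qed

end

section \<open>Denotations of proofs\<close>

locale sweedler = vector_space s
  for s :: "'k::field \<Rightarrow> 'v::ab_group_add \<Rightarrow> 'v" +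
  fixes S :: "'a fm set" and I :: "('a, 'k, 'v) interp"
  assumes semantics: "sweedler_semantics s S I"
begin

lemma sem_subspace: "A \<in> S \<Longrightarrow> subspace (sem I A)"
  using semantics by (simp add: sweedler_semantics_def)

lemma subformulas_in: "A \<in> S \<Longrightarrow> B \<in> subformulas A \<Longrightarrow> B \<in> S"
  using semantics by (auto simp: sweedler_semantics_def)

lemma self_subformula: "B \<in> subformulas B"
  by (cases B) auto

lemma Limp_in: "Limp A B \<in> S \<Longrightarrow> A \<in> S" "Limp A B \<in> S \<Longrightarrow> B \<in> S"
  using subformulas_in[of "Limp A B"] self_subformula by auto

lemma With_in: "With A B \<in> S \<Longrightarrow> A \<in> S" "With A B \<in> S \<Longrightarrow> B \<in> S"
  using subformulas_in[of "With A B"] self_subformula by auto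

lemma Bang_in: "Bang A \<in> S \<Longrightarrow> A \<in> S"
  using subformulas_in[of "Bang A"] self_subformula by auto

lemma app_linear:
  assumes "Limp A B \<in> S"
  shows "h \<in> sem I (Limp A B) \<Longrightarrow> linear_map_on s s (sem I A) (sem I B) (app I A B h)"
    and "x \<in> sem I A \<Longrightarrow> linear_map_on s s (sem I (Limp A B)) (sem I B) (\<lambda>h. app I A B h x)"
    and "linear_map_on s s (sem I A) (sem I B) f \<Longrightarrow>
      \<exists>!h. h \<in> sem I (Limp A B) \<and> (\<forall>x\<in>sem I A. app I A B h x = f x)"
  using semantics assms unfolding sweedler_semantics_def by blast+

text \<open>Extensionality of the internal hom: \<open>h\<close> and \<open>h'\<close> represent the
  same linear map, and the representing element is unique.\<close>

lemma app_ext: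
  assumes "Limp A B \<in> S" "h \<in> sem I (Limp A B)" "h' \<in> sem I (Limp A B)"
    and "\<And>x. x \<in> sem I A \<Longrightarrow> app I A B h x = app I A B h' x"
  shows "h = h'"
  using app_linear(3)[OF assms(1) app_linear(1)[OF assms(1,3)]] assms(2-4) by blast

lemma bang_cofree:
  "Bang A \<in> S \<Longrightarrow>
     is_cofree_cocomm_coalgebra s (sem I A) (sem I (Bang A)) (comul I A) (counit I A) (der I A)"
  using semantics by (simp add: sweedler_semantics_def)

lemma bang_coalgebra:
  "Bang A \<in> S \<Longrightarrow> is_cocomm_coalgebra s (sem I (Bang A)) (comul I A) (counit I A)"
  using bang_cofree by (simp add: is_cofree_cocomm_coalgebra_def)

section \<open>Abstraction as currying\<close>

lemma no_subspaces: "V \<in> set [] \<Longrightarrow> subspace V"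
  by simp

text \<open>Fixing the context leaves a linear map of the last argument, so the \<open>THE\<close>
  in the denotation is well defined. Linearity in the context is then checked pointwise, by
  extensionality of the internal hom.\<close>

lemma den_LimpR:
  assumes L: "Limp A B \<in> S" and Vs: "\<And>V. V \<in> set Vs \<Longrightarrow> subspace V"
    and p: "multilinear_map_on s s (Vs @ [sem I A]) (sem I B) (den s I p)"
  shows "zs \<in> listset Vs \<Longrightarrow> x \<in> sem I A \<Longrightarrow>
      app I A B (den s I (LimpR A B p) zs) x = den s I p (zs @ [x])"
    and "multilinear_map_on s s Vs (sem I (Limp A B)) (den s I (LimpR A B p))"
proof -
  let ?h = "den s I (LimpR A B p)"
  have nonempty: "sem I A \<noteq> {}"
    using sem_subspace Limp_in(1)[OF L] subspace_0 by blast
  have h: "?h zs \<in> sem I (Limp A B) \<and> (\<forall>x\<in>sem I A. app I A B (?h zs) x = den s I p (zs @ [x]))"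
    if "zs \<in> listset Vs" for zs
  proof -
    have "linear_map_on s s (sem I A) (sem I B) (\<lambda>x. den s I p (zs @ [x]))"
      using multilinear_map_on_ConsD'[OF multilinear_map_on_appendD2[OF p that] nonempty, of "[]"]
      by simp
    from theI'[OF app_linear(3)[OF L this]] show ?thesis by simp
  qed
  show "app I A B (?h zs) x = den s I p (zs @ [x])" if "zs \<in> listset Vs" "x \<in> sem I A"
    using h that by blast
  show "multilinear_map_on s s Vs (sem I (Limp A B)) ?h"
    unfolding multilinear_map_on_def
  proof (intro conjI ballI allI impI)
    show "?h ` listset Vs \<subseteq> sem I (Limp A B)" using h by blast
    fix zs i assume zs: "zs \<in> listset Vs" and i: "i < length Vs"
    have sub: "subspace (Vs ! i)" using Vs i by simp
    note upd = listset_update[OF zs i]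
    have lin: "linear_map_on s s (Vs ! i) (sem I B) (\<lambda>u. den s I p (zs[i := u] @ [x]))"
      if "x \<in> sem I A" for x
      using multilinear_map_on_linear[OF multilinear_map_on_appendD1[OF p] zs i] that
      by (simp add: set_Cons_def)
    note subL = sem_subspace[OF L]
    show "linear_map_on s s (Vs ! i) (sem I (Limp A B)) (\<lambda>u. ?h (zs[i := u]))"
    proof (rule linear_map_onI)
      show in_L: "?h (zs[i := u]) \<in> sem I (Limp A B)" if "u \<in> Vs ! i" for u
        using h upd that by blast
      fix u v assume u: "u \<in> Vs ! i" and v: "v \<in> Vs ! i"
      show "?h (zs[i := u + v]) = ?h (zs[i := u]) + ?h (zs[i := v])"
      proof (rule app_ext[OF L])
        show "?h (zs[i := u + v]) \<in> sem I (Limp A B)"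
          "?h (zs[i := u]) + ?h (zs[i := v]) \<in> sem I (Limp A B)"
          using in_L u v subspace_add[OF sub] subspace_add[OF subL] by blast+
        fix x assume x: "x \<in> sem I A"
        have "app I A B (?h (zs[i := u + v])) x = den s I p (zs[i := u + v] @ [x])"
          using h upd subspace_add[OF sub u v] x by blast
        also have "\<dots> = den s I p (zs[i := u] @ [x]) + den s I p (zs[i := v] @ [x])"
          using linear_map_onD(2)[OF lin[OF x] u v] .
        also have "\<dots> = app I A B (?h (zs[i := u])) x + app I A B (?h (zs[i := v])) x"
          using h upd u v x by metis
        also have "\<dots> = app I A B (?h (zs[i := u]) + ?h (zs[i := v])) x"
          using linear_map_onD(2)[OF app_linear(2)[OF L x] in_L[OF u] in_L[OF v]] by simp
        finally show "app I A B (?h (zs[i := u + v])) x =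
          app I A B (?h (zs[i := u]) + ?h (zs[i := v])) x" .
      qed
    next
      fix c u assume u: "u \<in> Vs ! i"
      have in_L: "?h (zs[i := u]) \<in> sem I (Limp A B)" using h upd u by blast
      show "?h (zs[i := s c u]) = s c (?h (zs[i := u]))"
      proof (rule app_ext[OF L])
        show "?h (zs[i := s c u]) \<in> sem I (Limp A B)"
          using h upd u subspace_scale[OF sub] by blast
        show "s c (?h (zs[i := u])) \<in> sem I (Limp A B)"
          using in_L subspace_scale[OF subL] by blast
        fix x assume x: "x \<in> sem I A"
        have "app I A B (?h (zs[i := s c u])) x = den s I p (zs[i := s c u] @ [x])"
          using h upd subspace_scale[OF sub u] x by blast
        also have "\<dots> = s c (den s I p (zs[i := u] @ [x]))"
          using linear_map_onD(3)[OF lin[OF x] u] .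
        also have "\<dots> = s c (app I A B (?h (zs[i := u])) x)"
          using h upd u x by metis
        also have "\<dots> = app I A B (s c (?h (zs[i := u]))) x"
          using linear_map_onD(3)[OF app_linear(2)[OF L x] in_L] by simp
        finally show "app I A B (?h (zs[i := s c u])) x = app I A B (s c (?h (zs[i := u]))) x" .
      qed
    qed
  qed
qed

section \<open>Multilinearity of the structural rules and of numeral bodies\<close>

lemma multilinear_Ax: "multilinear_map_on s s [sem I A] (sem I A) (den s I (Ax A))"
  by (rule multilinear_map_on_ConsI)
    (auto simp: linear_map_on_def multilinear_map_on_def)

lemma multilinear_Weak:
  assumes B: "Bang A \<in> S" and W: "subspace W"
    and p: "multilinear_map_on s s Vs W (den s I p)"
  shows "multilinear_map_on s s (sem I (Bang A) # Vs) W (den s I (Weak A p))"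
proof (rule multilinear_map_on_ConsI)
  have lin: "linear_map_on s (*) (sem I (Bang A)) UNIV (counit I A)"
    using bang_coalgebra[OF B] by (simp add: is_cocomm_coalgebra_def)
  fix zs assume "zs \<in> listset Vs"
  then show "linear_map_on s s (sem I (Bang A)) W (\<lambda>x. den s I (Weak A p) (x # zs))"
    by (intro linear_map_onI)
      (simp_all add: linear_map_onD(2,3)[OF lin] scale_left_distrib
        subspace_scale[OF W] multilinear_map_on_in[OF p])
next
  fix x assume "x \<in> sem I (Bang A)"
  show "multilinear_map_on s s Vs W (\<lambda>zs. den s I (Weak A p) (x # zs))"
    \<comment> \<open>Scaling by the counit of \<open>x\<close> is a linear combination with one
      term, indexed by the unit type.\<close>
    using multilinear_map_on_lincomb[OF W, of "{()}" s Vs "\<lambda>_. den s I p"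
        "\<lambda>_. counit I A x"] p
    by simp
qed

text \<open>In the contracted slot \<open>comul\<close> is linear only up to
  \<open>tensor_eq\<close>, a difference that the linear extension of a multilinear map ignores. In
  the other slots the comultiplication is fixed, which gives a finite linear combination of
  multilinear maps.\<close>

lemma multilinear_Contr:
  assumes B: "Bang A \<in> S" and W: "subspace W"
    and p: "multilinear_map_on s s (sem I (Bang A) # sem I (Bang A) # Vs) W (den s I p)"
  shows "multilinear_map_on s s (sem I (Bang A) # Vs) W (den s I (Contr A p))"
proof (rule multilinear_map_on_ConsI)
  let ?E = "sem I (Bang A)"
  have co: "comul I A x \<in> formal [?E, ?E]"
    "x' \<in> ?E \<Longrightarrow> tensor_eq s [?E, ?E] (comul I A (x + x')) (comul I A x + comul I A x')"
    "tensor_eq s [?E, ?E] (comul I A (s c x)) (fscale c (comul I A x))" if "x \<in> ?E" for x x' c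
    using bang_coalgebra[OF B] that unfolding is_cocomm_coalgebra_def by blast+
  have p': "multilinear_map_on s s ([?E, ?E] @ Vs) W (den s I p)" using p by simp
  {
    fix zs assume zs: "zs \<in> listset Vs"
    note ml = multilinear_map_on_appendD1[OF p' zs]
    have "lin_ext s (\<lambda>xs. den s I p (xs @ zs)) (comul I A x) \<in> W" if "x \<in> ?E" for x
      unfolding lin_ext_def
      using co(1)[OF that] multilinear_map_on_in[OF ml]
      by (intro subspace_sum[OF W] subspace_scale[OF W]) (auto simp: formal_def)
    then show "linear_map_on s s ?E W (\<lambda>x. den s I (Contr A p) (x # zs))"
      using lin_ext_tensor_eq[OF ml co(2)] lin_ext_tensor_eq[OF ml co(3)]
      by (intro linear_map_onI) (simp_all add: lin_ext_add lin_ext_fscale)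
  }
  fix x assume x: "x \<in> ?E"
  have "multilinear_map_on s s Vs W (\<lambda>zs. den s I p (xs @ zs))"
    if "xs \<in> Poly_Mapping.keys (comul I A x)" for xs
    using that co(1)[OF x] by (intro multilinear_map_on_appendD2[OF p']) (auto simp: formal_def)
  then show "multilinear_map_on s s Vs W (\<lambda>zs. den s I (Contr A p) (x # zs))"
    using multilinear_map_on_lincomb[OF W, of "Poly_Mapping.keys (comul I A x)" s Vs
        "\<lambda>xs zs. den s I p (xs @ zs)" "Poly_Mapping.lookup (comul I A x)"]
    by (simp add: lin_ext_def)
qed

lemma multilinear_contract:
  assumes "Bang A \<in> S" "subspace W"
    and "multilinear_map_on s s (replicate m (sem I (Bang A)) @ Vs) W (den s I p)"
  shows "multilinear_map_on s s (sem I (Bang A) # Vs) W (den s I (contract A m p))"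
  using assms(3)
\<comment> \<open>The cases 0, 1 and \<open>m + 2\<close> follow \<open>contract\<close>;
  \<open>p\<close> is arbitrary because the recursion replaces it by
  \<open>Contr A p\<close>.\<close>
proof (induction m arbitrary: p rule: induct_nat_012)
  case 0
  then show ?case using multilinear_Weak[OF assms(1,2), of Vs p] by (simp del: den.simps)
next
  case 1
  then show ?case by simp
next
  case (ge2 m)
  then show ?case using multilinear_Contr[OF assms(1,2)] by (simp del: den.simps)
qed

text \<open>The length condition makes \<open>take\<close> hand all of \<open>zs\<close> to the
  argument of the application, while \<open>drop\<close> leaves nothing beside the formula of the
  axiom.\<close>

lemma den_church_body_Suc:
  assumes "length zs = Suc m"
  shows "den s I (church_body A (Suc m)) (x # zs) =
    app I A A (der I (Limp A A) x) (den s I (church_body A m) zs)"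
  using assms by simp

lemma listset_church:
  "zs \<in> listset (replicate m V @ [W]) \<Longrightarrow> length zs = Suc m"
  by (auto dest: listset_length)

text \<open>The new factor enters through dereliction and application, and application is linear in
  the function for a fixed argument and in the argument for a fixed function.\<close>

lemma multilinear_church_body:
  assumes B: "Bang (Limp A A) \<in> S"
  shows "multilinear_map_on s s (replicate m (sem I (Bang (Limp A A))) @ [sem I A]) (sem I A)
    (den s I (church_body A m))"
proof (induction m)
  case 0
  show ?case using multilinear_Ax by simp
next
  case (Suc m)
  let ?E = "sem I (Bang (Limp A A))" and ?L = "sem I (Limp A A)"
  let ?Vs = "replicate m ?E @ [sem I A]"
  have L: "Limp A A \<in> S" using Bang_in[OF B] .
  have sub: "subspace V" if "V \<in> set ?Vs" for V
    using that sem_subspace B Limp_in(1)[OF L] by (auto split: if_splits)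
  have der: "linear_map_on s s ?E ?L (der I (Limp A A))"
    using bang_cofree[OF B] by (simp add: is_cofree_cocomm_coalgebra_def)
  have "multilinear_map_on s s (?E # ?Vs) (sem I A) (den s I (church_body A (Suc m)))"
  proof (rule multilinear_map_on_ConsI)
    fix zs assume zs: "zs \<in> listset ?Vs"
    from linear_map_on_compose[OF der app_linear(2)[OF L multilinear_map_on_in[OF Suc zs]]]
    show "linear_map_on s s ?E (sem I A) (\<lambda>x. den s I (church_body A (Suc m)) (x # zs))"
      using den_church_body_Suc[OF listset_church[OF zs]] by simp
  next
    fix x assume "x \<in> ?E"
    then have app: "linear_map_on s s (sem I A) (sem I A) (app I A A (der I (Limp A A) x))"
      using app_linear(1)[OF L] linear_map_onD(1)[OF der] by blast
    have "multilinear_map_on s s ?Vs (sem I A)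
      (\<lambda>zs. app I A A (der I (Limp A A) x) (den s I (church_body A m) zs))"
      using linear_map_on_compose[OF multilinear_map_on_linear[OF Suc] app]
        linear_map_onD(1)[OF app] multilinear_map_on_in[OF Suc]
      unfolding multilinear_map_on_def by blast
    \<comment> \<open>The recursion for the denotation needs lists of the right length, hence the
      passage through congruence on \<open>listset ?Vs\<close>.\<close>
    then show "multilinear_map_on s s ?Vs (sem I A)
      (\<lambda>zs. den s I (church_body A (Suc m)) (x # zs))"
      by (rule multilinear_map_on_cong)
        (use sub den_church_body_Suc[OF listset_church] module_axioms in auto)
  qed
  then show ?case by simp
qed

section \<open>Numerals at group-like elements\<close>

lemma den_contract_grouplike:
  assumes "Bang A \<in> S" "subspace W" "e \<in> sem I (Bang A)" "counit I A e = 1"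
    and e: "tensor_eq s [sem I (Bang A), sem I (Bang A)] (comul I A e) (pure [e, e])"
    and "multilinear_map_on s s (replicate m (sem I (Bang A)) @ Vs) W (den s I p)"
    and zs: "zs \<in> listset Vs"
  shows "den s I (contract A m p) (e # zs) = den s I p (replicate m e @ zs)"
  using assms(6)
proof (induction m arbitrary: p rule: induct_nat_012)
  case 0
  show ?case using assms(4) by simp
next
  case 1
  show ?case by simp
next
  case (ge2 m)
  let ?E = "sem I (Bang A)"
  have p: "multilinear_map_on s s ([?E, ?E] @ replicate m ?E @ Vs) W (den s I p)"
    using ge2.prems by simp
  have ez: "replicate m e @ zs \<in> listset (replicate m ?E @ Vs)"
    using zs assms(3) by (intro listset_append) (auto simp: listset_iff list_all2_conv_all_nth)
  \<comment> \<open>The induction hypothesis, applied to \<open>Contr A p\<close>, supplies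
    \<open>Suc m\<close> copies of \<open>e\<close>; the remaining contraction then doubles the
    first copy.\<close>
  have "den s I (contract A (Suc (Suc m)) p) (e # zs) =
    den s I (Contr A p) (replicate (Suc m) e @ zs)"
    using ge2.IH(2)[of "Contr A p"] multilinear_Contr[OF assms(1,2) p[simplified]] by simp
  also have "\<dots> = den s I p ([e, e] @ replicate m e @ zs)"
    using lin_ext_tensor_eq[OF multilinear_map_on_appendD1[OF p ez] e]
    by (simp add: lin_ext_single)
  finally show ?case by simp
qed

lemma den_church:
  assumes int: "int_fm A \<in> S"
  shows "den s I (church A m) [] \<in> sem I (int_fm A)"
    and "e \<in> sem I (Bang (Limp A A)) \<Longrightarrow> a \<in> sem I A \<Longrightarrow>
      app I A A (app I (Bang (Limp A A)) (Limp A A) (den s I (church A m) []) e) a =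
      den s I (contract (Limp A A) m (church_body A m)) [e, a]"
proof -
  let ?L = "Limp A A" and ?p = "contract (Limp A A) m (church_body A m)"
  have int': "Limp (Bang ?L) ?L \<in> S" using int by (simp add: int_fm_def)
  note B = Limp_in(1)[OF int'] and L = Limp_in(2)[OF int']
  have sub: "subspace V" if "V \<in> set [sem I (Bang ?L)]" for V
    using that sem_subspace[OF B] by simp
  have "multilinear_map_on s s ([sem I (Bang ?L)] @ [sem I A]) (sem I A) (den s I ?p)"
    using multilinear_contract[OF B sem_subspace[OF Limp_in(1)[OF L]] multilinear_church_body[OF B]]
    by simp
  note inner = den_LimpR[OF L sub this]
  \<comment> \<open>The empty prefix exhibits the outer abstraction as currying in an empty
    context.\<close>
  have "multilinear_map_on s s ([] @ [sem I (Bang ?L)]) (sem I ?L) (den s I (LimpR A A ?p))"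
    using inner(2) by simp
  note outer = den_LimpR[OF int' no_subspaces this]
  show "den s I (church A m) [] \<in> sem I (int_fm A)"
    using multilinear_map_on_in[OF outer(2), of "[]"] by (simp add: church_def int_fm_def del: den.simps)
  show "app I A A (app I (Bang ?L) ?L (den s I (church A m) []) e) a = den s I ?p [e, a]"
    if "e \<in> sem I (Bang ?L)" "a \<in> sem I A"
    using outer(1)[of "[]" e] inner(1)[of "[e]" a] that
    by (simp add: church_def set_Cons_def del: den.simps)
qed

text \<open>Each of the \<open>m\<close> derelicted copies of \<open>e\<close> acts as
  multiplication by \<open>c\<close>.\<close>

lemma den_church_body_scalar:
  assumes "A \<in> S" "a \<in> sem I A"
    and "\<And>x. x \<in> sem I A \<Longrightarrow> app I A A (der I (Limp A A) e) x = s c x"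
  shows "den s I (church_body A m) (replicate m e @ [a]) = s (c ^ m) a"
proof (induction m)
  case 0
  show ?case by simp
next
  case (Suc m)
  then show ?case
    using den_church_body_Suc[of "replicate m e @ [a]" m A e] assms(3)
      subspace_scale[OF sem_subspace[OF assms(1)] assms(2)]
    by simp
qed

text \<open>Evaluation at \<open>e\<close> and then at \<open>a\<close> is linear in the numeral,
  where \<open>e\<close> lies over \<open>c\<close> times the identity. For \<open>c = 0\<close> the
  convention \<open>0 ^ 0 = 1\<close> agrees with the numeral 0, which discards
  \<open>e\<close>.\<close>

lemma church_evaluation:
  assumes int: "int_fm A \<in> S" and a: "a \<in> sem I A" "a \<noteq> 0"
  obtains \<Phi> where "linear_map_on s s (sem I (int_fm A)) (sem I A) \<Phi>"
    "\<And>m. \<Phi> (den s I (church A m) []) = s (c ^ m) a"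
proof -
  let ?L = "Limp A A"
  have int': "Limp (Bang ?L) ?L \<in> S" using int by (simp add: int_fm_def)
  note B = Limp_in(1)[OF int'] and L = Limp_in(2)[OF int']
  note A = Limp_in(1)[OF L]
  have "linear_map_on s s (sem I A) (sem I A) (s c)"
    by (rule linear_map_onI)
      (auto simp: subspace_scale[OF sem_subspace[OF A]] scale_right_distrib mult.commute)
  from app_linear(3)[OF L this]
  obtain h where h: "h \<in> sem I ?L" "\<And>x. x \<in> sem I A \<Longrightarrow> app I A A h x = s c x" by blast
  \<comment> \<open>\<open>a\<close> also serves as the nonzero ambient vector spanning the test
    coalgebra.\<close>
  obtain e where e: "e \<in> sem I (Bang ?L)" "counit I ?L e = 1" "der I ?L e = h"
    "tensor_eq s [sem I (Bang ?L), sem I (Bang ?L)] (comul I ?L e) (pure [e, e])"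
    using grouplike_exists[OF bang_cofree[OF B] sem_subspace[OF L] h(1) a(2)] by metis
  show thesis
  proof
    show "linear_map_on s s (sem I (int_fm A)) (sem I A)
      (\<lambda>n. app I A A (app I (Bang ?L) ?L n e) a)"
      unfolding int_fm_def
      using linear_map_on_compose[OF app_linear(2)[OF int' e(1)] app_linear(2)[OF L a(1)]] .
    fix m
    have "den s I (contract ?L m (church_body A m)) [e, a] =
      den s I (church_body A m) (replicate m e @ [a])"
      using a(1)
      by (intro den_contract_grouplike[OF B sem_subspace[OF A] e(1,2,4) multilinear_church_body[OF B]])
        (simp add: set_Cons_def)
    then show "app I A A (app I (Bang ?L) ?L (den s I (church A m) []) e) a = s (c ^ m) a"
      using den_church(2)[OF int e(1) a(1)] den_church_body_scalar[OF A a(1)] h(2) e(3) by simp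
  qed
qed

section \<open>Tuples, projections and booleans\<close>

lemma with_linear:
  assumes "With A B \<in> S"
  shows "linear_map_on s s (sem I (With A B)) (sem I A) (proj1 I A B)"
    and "linear_map_on s s (sem I (With A B)) (sem I B) (proj2 I A B)"
  using semantics assms by (simp_all add: sweedler_semantics_def)

lemma with_pair:
  assumes "With A B \<in> S" "a \<in> sem I A" "b \<in> sem I B"
  obtains z where "z \<in> sem I (With A B)" "proj1 I A B z = a" "proj2 I A B z = b"
proof -
  have "(a, b) \<in> (\<lambda>z. (proj1 I A B z, proj2 I A B z)) ` sem I (With A B)"
    using semantics assms unfolding sweedler_semantics_def bij_betw_def by auto
  then show thesis using that by auto
qed

lemma projection_linear:
  assumes "with_power A n \<in> S"
  shows "linear_map_on s s (sem I (with_power A n)) (sem I A) (\<lambda>z. den s I (projection A n i) [z])"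
  using assms
proof (induction A n i rule: projection.induct)
  case (1 A n)
  then show ?case using with_linear(1) by (simp add: linear_map_on_def)
next
  case (2 A n i)
  then have W: "With A (with_power A (Suc n)) \<in> S" by simp
  show ?case
    using linear_map_on_compose[OF with_linear(2)[OF W] 2(1)[OF With_in(2)[OF W]]] by simp
qed (simp_all add: linear_map_on_def)

lemma projection_zero:
  assumes "with_power A n \<in> S"
  shows "den s I (projection A n i) [0] = 0"
proof -
  have "subspace (sem I (with_power A n))" using sem_subspace assms .
  from linear_map_onD(3)[OF projection_linear[OF assms] subspace_0[OF this], where c = 0]
  show ?thesis by simp
qed

lemma with_power_unit:
  assumes "with_power A n \<in> S" "a \<in> sem I A" "i < n"
  obtains z where "z \<in> sem I (with_power A n)"
    "\<And>j. j < n \<Longrightarrow> den s I (projection A n j) [z] = (if j = i then a else 0)"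
proof -
  have "\<exists>z\<in>sem I (with_power A n).
    \<forall>j<n. den s I (projection A n j) [z] = (if j = i then a else 0)"
    using assms
  proof (induction A n i rule: projection.induct)
    case (1 A n)
    then have W: "With A (with_power A (Suc n)) \<in> S" by simp
    \<comment> \<open>At position 0 the unit tuple has head \<open>a\<close> and zero tail, on which
      all projections vanish.\<close>
    from with_pair[OF W 1(2) subspace_0[OF sem_subspace[OF With_in(2)[OF W]]]]
    obtain z where "z \<in> sem I (With A (with_power A (Suc n)))"
      "proj1 I A (with_power A (Suc n)) z = a" "proj2 I A (with_power A (Suc n)) z = 0" .
    then show ?case
      using projection_zero[OF With_in(2)[OF W]]
      by (intro bexI[of _ z]) (auto simp: less_Suc_eq_0_disj)
  next
    case (2 A n i)
    then have W: "With A (with_power A (Suc n)) \<in> S" by simp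
    from 2(1)[OF With_in(2)[OF W]] 2(3,4)
    obtain y where y: "y \<in> sem I (with_power A (Suc n))"
      "\<forall>j<Suc n. den s I (projection A (Suc n) j) [y] = (if j = i then a else 0)" by auto
    \<comment> \<open>At a later position the head is 0 and the tail is the unit tuple shifted by
      one.\<close>
    from with_pair[OF W subspace_0[OF sem_subspace[OF With_in(1)[OF W]]] y(1)]
    obtain z where z: "z \<in> sem I (With A (with_power A (Suc n)))"
      "proj1 I A (with_power A (Suc n)) z = 0" "proj2 I A (with_power A (Suc n)) z = y" .
    have "den s I (projection A (Suc (Suc n)) j) [z] = (if j = Suc i then a else 0)"
      if "j < Suc (Suc n)" for j
      using that y(2) z(2,3) by (cases j) auto
    with z(1) show ?case unfolding with_power.simps by blast
  \<comment> \<open>In the remaining cases \<open>n\<close> is 0, excluded by \<open>i < n\<close>,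
    or 1, where \<open>a\<close> itself is the tuple.\<close>
  qed auto
  then show thesis using that by blast
qed

lemma den_boolean:
  assumes "bool_fm n A \<in> S"
  shows "den s I (boolean A n i) [] \<in> sem I (bool_fm n A)"
    and "z \<in> sem I (with_power A n) \<Longrightarrow>
      app I (with_power A n) A (den s I (boolean A n i) []) z = den s I (projection A n i) [z]"
proof -
  have L: "Limp (with_power A n) A \<in> S" using assms by (simp add: bool_fm_def)
  have "multilinear_map_on s s ([] @ [sem I (with_power A n)]) (sem I A) (den s I (projection A n i))"
    using projection_linear[OF Limp_in(1)[OF L]]
    by (auto intro!: multilinear_map_on_ConsI
        simp: multilinear_map_on_def image_subset_iff linear_map_on_def)
  note den = den_LimpR[OF L no_subspaces this]
  show "den s I (boolean A n i) [] \<in> sem I (bool_fm n A)"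
    using multilinear_map_on_in[OF den(2), of "[]"] by (simp add: boolean_def bool_fm_def del: den.simps)
  show "z \<in> sem I (with_power A n) \<Longrightarrow>
      app I (with_power A n) A (den s I (boolean A n i) []) z = den s I (projection A n i) [z]"
    using den(1)[of "[]" z] by (simp add: boolean_def del: den.simps)
qed

section \<open>Independence of booleans and numerals\<close>

lemma positive_dim_nonzero:
  assumes "positive_dim s V"
  obtains a where "a \<in> V" "a \<noteq> 0"
proof -
  from assms obtain B b where B: "independent B" "span B = V" "b \<in> B"
    unfolding positive_dim_def by blast
  then have "b \<in> V" using span_base by blast
  moreover have "b \<noteq> 0" using B dependent_zero by blast
  ultimately show thesis using that by blast
qed

lemma booleans_independent:
  assumes bool: "bool_fm n A \<in> S" and a: "a \<in> sem I A" "a \<noteq> 0"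
  shows "independent_family_in s (sem I (bool_fm n A)) {..<n} (\<lambda>i. den s I (boolean A n i) [])"
proof (rule independent_family_inI[OF den_boolean(1)[OF bool]])
  have L: "Limp (with_power A n) A \<in> S" using bool by (simp add: bool_fm_def)
  fix T :: "nat set" and c i
  assume T: "finite T" "T \<subseteq> {..<n}" "(\<Sum>j\<in>T. s (c j) (den s I (boolean A n j) [])) = 0" "i \<in> T"
  from with_power_unit[OF Limp_in(1)[OF L] a(1), of i] T
  obtain z where z: "z \<in> sem I (with_power A n)"
    "\<And>j. j < n \<Longrightarrow> den s I (projection A n j) [z] = (if j = i then a else 0)" by blast
  let ?\<Phi> = "\<lambda>h. app I (with_power A n) A h z"
  note lin = app_linear(2)[OF L z(1)]
  \<comment> \<open>The empty linear combination yields the value at 0.\<close>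
  have "0 = ?\<Phi> 0"
    using linear_map_on_sum[OF lin sem_subspace[OF L], where J = "{}"] by simp
  also have "\<dots> = (\<Sum>j\<in>T. s (c j) (?\<Phi> (den s I (boolean A n j) [])))"
    using linear_map_on_sum[OF lin sem_subspace[OF L], of T "\<lambda>j. den s I (boolean A n j) []" c]
      den_boolean(1)[OF bool] T by (simp add: bool_fm_def)
  also have "\<dots> = (\<Sum>j\<in>T. if j = i then s (c i) a else 0)"
    using T(2) by (intro sum.cong) (auto simp: den_boolean(2)[OF bool z(1)] z(2))
  also have "\<dots> = s (c i) a" using T by simp
  finally show "c i = 0" using a(2) by simp
qed

end

text \<open>Stated outside the locale because the locale allows any field of scalars, whereas
  algebraic closure is used here to have infinitely many of them.\<close>

lemma numerals_independent:
  fixes s :: "'k::alg_closed_field \<Rightarrow> 'v::ab_group_add \<Rightarrow> 'v"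
  assumes "sweedler s S I" and int: "int_fm A \<in> S" and a: "a \<in> sem I A" "a \<noteq> 0"
  shows "independent_family_in s (sem I (int_fm A)) UNIV (\<lambda>m::nat. den s I (church A m) [])"
proof -
  interpret sweedler s S I by fact
  show ?thesis
  proof (rule independent_family_inI[OF den_church(1)[OF int]])
    fix T :: "nat set" and c m
    assume T: "finite T" "(\<Sum>m\<in>T. s (c m) (den s I (church A m) [])) = 0" "m \<in> T"
    \<comment> \<open>Every scalar \<open>x\<close> has its own group-like element, so the
      evaluation \<open>\<Phi>\<close> is chosen after \<open>x\<close>.\<close>
    have "(\<Sum>m\<in>T. c m * x ^ m) = 0" for x
    proof -
      obtain \<Phi> where \<Phi>: "linear_map_on s s (sem I (int_fm A)) (sem I A) \<Phi>"
        "\<And>m. \<Phi> (den s I (church A m) []) = s (x ^ m) a"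
        using church_evaluation[OF int a] by metis
      note sum = linear_map_on_sum[OF \<Phi>(1) sem_subspace[OF int]]
      have "s (\<Sum>m\<in>T. c m * x ^ m) a = \<Phi> 0"
        using sum[of T "\<lambda>m. den s I (church A m) []" c] den_church(1)[OF int] T \<Phi>(2)
        by (simp add: scale_sum_left)
      also have "\<Phi> 0 = 0" using sum[where J = "{}"] by simp
      finally show ?thesis using a(2) by simp
    qed
    with T show "c m = 0" using finite_power_sum_vanishes[of T c m] by blast
  qed
qed

theorem propositionB1:
  fixes s :: "'k::alg_closed_field \<Rightarrow> 'v::ab_group_add \<Rightarrow> 'v"
    and S :: "'a fm set"
    and I :: "('a, 'k, 'v) interp"
    and A :: "'a fm"
  assumes "sweedler_semantics s S I"
    and "A \<in> S"
    and "positive_dim s (sem I A)"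
  shows "(int_fm A \<in> S \<longrightarrow>
            independent_family_in s (sem I (int_fm A)) UNIV (\<lambda>m::nat. den s I (church A m) [])) \<and>
         (\<forall>n\<ge>1. bool_fm n A \<in> S \<longrightarrow>
            independent_family_in s (sem I (bool_fm n A)) {..<n} (\<lambda>i. den s I (boolean A n i) []))"
proof -
  have sw: "sweedler s S I"
    using assms(1)
    by (simp add: sweedler_def sweedler_axioms_def) (simp add: sweedler_semantics_def)
  interpret sweedler s S I by (rule sw)
  \<comment> \<open>One vector serves both halves: as the argument of the numerals and as the
    nonzero entry of the unit tuples.\<close>
  obtain a where "a \<in> sem I A" "a \<noteq> 0"
    using positive_dim_nonzero[OF assms(3)] .
  then show ?thesis
    using numerals_independent[OF sw] booleans_independent by blast
qed

end
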